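(* Fix a real number $c \ge 1$. For positive integers $n$ such that $cn$ is an integer, put $p = n$ and $q = cn$, and let $X_{p,q}$ be the random variable whose law is $$\mathbb{P}(X_{p,q} = k) \;=\; \frac{u((p,q),k)}{\sum_{j \ge 0} u((p,q),j)}, \qquad k = 0,1,2,\dots,$$ i.e. $X_{p,q}$ is the length of an unrestricted generalized jump path starting at $(p,q)$ chosen uniformly at random. Set $$\mu_{p,q} = \frac{p+q+\sqrt{p^2+6pq+q^2}}{4}, \qquad \sigma_{p,q}^2 = \frac{p+q}{8} + \frac{(p+q)^2}{8\sqrt{p^2+6pq+q^2}}.$$ Then, as $n \to \infty$, $(X_{p,q} - \mu_{p,q})/\sigma_{p,q}$ converges in distribution to a standard normal random variable. In other words, $X_{p,q}$ is asymptotically Gaussian with mean $\mu_{p,q}$ and variance $\sigma^2_{p,q}$.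
   Context: Let $\mathbb{N} = \{0,1,2,\dots\}$ and let $d \ge 1$. For $v \in \mathbb{N}^d$ and $n \in \mathbb{N}$, an unrestricted generalized jump path of length $n$ starting at $v$ is a sequence $(x_0, x_1, \dots, x_n)$ of points of $\mathbb{N}^d$ satisfying three conditions: - $x_0 = v$; - for every $i$, each coordinate of $x_{i+1}$ is at most the corresponding coordinate of $x_i$; - $x_{i+1} \neq x_i$ for every $i$. Let $u(v,n)$ denote the number of such paths. In dimension $d = 2$ we write $u((p,q),n)$. *)

theory Defs
  imports "HOL-Probability.Probability"
begin

definition ujump_paths :: "nat \<times> nat \<Rightarrow> nat \<Rightarrow> (nat \<times> nat) list set" where
  "ujump_paths v n = {xs. length xs = Suc n \<and> xs ! 0 = v \<and>
     (\<forall>i<n. fst (xs ! Suc i) \<le> fst (xs ! i) \<and> snd (xs ! Suc i) \<le> snd (xs ! i)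
            \<and> xs ! Suc i \<noteq> xs ! i)}"

definition u :: "nat \<times> nat \<Rightarrow> nat \<Rightarrow> nat" where
  "u v n = card (ujump_paths v n)"

definition X_prob :: "nat \<Rightarrow> nat \<Rightarrow> nat \<Rightarrow> real" where
  "X_prob p q k = real (u (p, q) k) / (\<Sum>j. real (u (p, q) j))"

definition mu_pq :: "nat \<Rightarrow> nat \<Rightarrow> real" where
  "mu_pq p q = (real p + real q + sqrt (real p ^ 2 + 6 * real p * real q + real q ^ 2)) / 4"

definition sigma2_pq :: "nat \<Rightarrow> nat \<Rightarrow> real" where
  "sigma2_pq p q = (real p + real q) / 8
     + (real p + real q) ^ 2 / (8 * sqrt (real p ^ 2 + 6 * real p * real q + real q ^ 2))"

definition X_std_cdf :: "nat \<Rightarrow> nat \<Rightarrow> real \<Rightarrow> real" where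
  "X_std_cdf p q x = (\<Sum>k. if (real k - mu_pq p q) / sqrt (sigma2_pq p q) \<le> x
                             then X_prob p q k else 0)"

end

theory Submission
  imports Defs "HOL-Real_Asymp.Real_Asymp"
begin

text \<open>
  Inclusion-exclusion on the endpoint of the first step gives
  \<open>\<Sum>\<^sub>k u (p,q) k z^k = \<Sum>\<^sub>j (p choose j) (q choose j) z^j (1 + z)^(p + q - j)\<close>,
  so the length is distributed like \<open>J + Bin(p + q - J, 1/2)\<close>, where \<open>J\<close> has weights proportional to
  \<open>(p choose j) (q choose j) / 2^j\<close>. The ratio of consecutive weights yields
  \<open>E ((p - J) (q - J) g (J + 1)) = 2 E (J^2 g J)\<close> for every \<open>g\<close>. Let \<open>a \<ge> 0\<close> be the root of
  \<open>(p - a) (q - a) = 2 a^2\<close>. Taking \<open>g j = j - a\<close> bounds the variance of \<open>J\<close> by \<open>(p + q) / 4\<close>;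
  taking \<open>g j = cis (t (j - a))\<close> shows that the characteristic function of \<open>J - a\<close> satisfies
  \<open>\<phi>' = - v t \<phi>\<close> up to a bounded error for \<open>t = O((p + q) powr (-1/2))\<close>. Hence the standardized
  characteristic function of the length is Gaussian up to \<open>O((p + q) powr (-1/2))\<close>, and Levy's
  continuity theorem applies.
\<close>

section \<open>Recurrences for the number of paths\<close>

lemma ujump_paths_0: "ujump_paths v 0 = {[v]}"
  by (auto simp: ujump_paths_def length_Suc_conv)

lemma Cons_in_ujump_paths_iff:
  "v # xs \<in> ujump_paths (p, q) (Suc n) \<longleftrightarrow>
     v = (p, q) \<and> xs ! 0 \<in> {..p} \<times> {..q} - {(p, q)} \<and> xs \<in> ujump_paths (xs ! 0) n"
  by (cases "xs ! 0") (auto simp: ujump_paths_def All_less_Suc2)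

lemma ujump_paths_Suc:
  "ujump_paths (p, q) (Suc n) = (\<Union>w\<in>{..p} \<times> {..q} - {(p, q)}. (#) (p, q) ` ujump_paths w n)"
proof (intro equalityI subsetI)
  fix xs assume xs: "xs \<in> ujump_paths (p, q) (Suc n)"
  then obtain v ys where "xs = v # ys"
    by (cases xs) (simp_all add: ujump_paths_def)
  with xs show "xs \<in> (\<Union>w\<in>{..p} \<times> {..q} - {(p, q)}. (#) (p, q) ` ujump_paths w n)"
    using Cons_in_ujump_paths_iff[of v ys p q n] by (intro UN_I[of "ys ! 0"]) simp_all
next
  fix xs assume "xs \<in> (\<Union>w\<in>{..p} \<times> {..q} - {(p, q)}. (#) (p, q) ` ujump_paths w n)"
  then obtain w ys where ys: "xs = (p, q) # ys" "ys \<in> ujump_paths w n" and w: "w \<in> {..p} \<times> {..q} - {(p, q)}"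
    by blast
  from ys(2) have "ys ! 0 = w"
    by (simp add: ujump_paths_def)
  with ys w show "xs \<in> ujump_paths (p, q) (Suc n)"
    by (simp only: Cons_in_ujump_paths_iff)
qed

lemma finite_ujump_paths: "finite (ujump_paths v n)"
  by (induction n arbitrary: v) (auto simp: ujump_paths_0 ujump_paths_Suc split_paired_all)

lemma u_0 [simp]: "u v 0 = 1"
  by (simp add: u_def ujump_paths_0)

lemma u_Suc: "u (p, q) (Suc n) = (\<Sum>w\<in>{..p} \<times> {..q} - {(p, q)}. u w n)"
proof -
  have disj: "(#) (p, q) ` ujump_paths v n \<inter> (#) (p, q) ` ujump_paths w n = {}" if "v \<noteq> w" for v w
    using that by (auto simp: ujump_paths_def)
  have "u (p, q) (Suc n) = (\<Sum>w\<in>{..p} \<times> {..q} - {(p, q)}. card ((#) (p, q) ` ujump_paths w n))"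
    unfolding u_def ujump_paths_Suc
    by (intro card_UN_disjoint) (auto simp: finite_ujump_paths disj)
  then show ?thesis
    by (simp add: u_def card_image)
qed

text \<open>Each step lowers the sum of the coordinates by at least one. This turns every series
  over path lengths into a finite sum.\<close>

lemma u_eq_0: "p + q < k \<Longrightarrow> u (p, q) k = 0"
proof (induction k arbitrary: p q)
  case (Suc k)
  have "u w k = 0" if "w \<in> {..p} \<times> {..q} - {(p, q)}" for w
    using that Suc.prems by (cases w) (auto intro!: Suc.IH)
  then show ?case
    by (simp add: u_Suc)
qed simp

text \<open>Adding \<open>u (p, q) k\<close> restores the forbidden zero step, so the first step may
  end anywhere in the full rectangle below \<open>(p, q)\<close>.\<close>

lemma u_Suc_add: "u (p, q) (Suc k) + u (p, q) k = (\<Sum>a\<le>p. \<Sum>b\<le>q. u (a, b) k)"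
proof -
  have "(\<Sum>a\<le>p. \<Sum>b\<le>q. u (a, b) k) = (\<Sum>w\<in>{..p} \<times> {..q}. u w k)"
    by (simp add: sum.cartesian_product)
  also have "\<dots> = u (p, q) k + (\<Sum>w\<in>{..p} \<times> {..q} - {(p, q)}. u w k)"
    by (intro sum.remove) auto
  finally show ?thesis by (simp add: u_Suc)
qed

text \<open>Inclusion-exclusion for the four rectangle sums of \<open>u_Suc_add\<close> leaves only
  the corner term \<open>u (Suc p, Suc q) k\<close>, which cancels. The terms are arranged without
  subtraction because they are natural numbers.\<close>

lemma u_Suc_Suc_Suc:
  "u (Suc p, Suc q) (Suc k) + (u (p, q) (Suc k) + u (p, q) k)
     = (u (p, Suc q) (Suc k) + u (p, Suc q) k) + (u (Suc p, q) (Suc k) + u (Suc p, q) k)"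
  using u_Suc_add[of "Suc p" "Suc q" k] u_Suc_add[of p "Suc q" k]
    u_Suc_add[of "Suc p" q k] u_Suc_add[of p q k]
  by (simp add: sum.distrib)

lemma u_Suc_zero_Suc: "u (Suc p, 0) (Suc k) = u (p, 0) (Suc k) + u (p, 0) k"
  using u_Suc_add[of "Suc p" 0 k] u_Suc_add[of p 0 k] by simp

lemma u_commute: "u (p, q) k = u (q, p) k"
proof (induction k arbitrary: p q)
  case (Suc k)
  have "u (p, q) (Suc k) + u (p, q) k = u (q, p) (Suc k) + u (q, p) k"
    unfolding u_Suc_add by (subst sum.swap) (simp add: Suc)
  then show ?case by (simp add: Suc)
qed simp

section \<open>Generating polynomial of the path counts\<close>

definition path_poly :: "nat \<Rightarrow> nat \<Rightarrow> complex \<Rightarrow> complex" where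
  "path_poly p q z = (\<Sum>k\<le>p + q. of_nat (u (p, q) k) * z ^ k)"

lemma path_poly_eq:
  assumes "p + q \<le> K"
  shows "path_poly p q z = (\<Sum>k\<le>K. of_nat (u (p, q) k) * z ^ k)"
  unfolding path_poly_def using assms
  by (intro sum.mono_neutral_left) (auto simp: u_eq_0)

lemma path_poly_eq_Suc:
  assumes "p + q \<le> Suc K"
  shows "path_poly p q z = 1 + z * (\<Sum>k\<le>K. of_nat (u (p, q) (Suc k)) * z ^ k)"
  unfolding path_poly_eq[OF assms] sum.atMost_Suc_shift[of _ K] sum_distrib_left
  by (simp add: mult_ac)

text \<open>Multiplication by \<open>1 + z\<close> produces exactly the sums of consecutive counts
  that occur in \<open>u_Suc_Suc_Suc\<close>.\<close>

lemma path_poly_add: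
  assumes "p + q \<le> K"
  shows "(1 + z) * path_poly p q z =
    1 + z * (\<Sum>k\<le>K. (of_nat (u (p, q) (Suc k)) + of_nat (u (p, q) k)) * z ^ k)"
proof -
  have "(1 + z) * path_poly p q z = path_poly p q z + z * path_poly p q z"
    by (rule distrib_right[of 1 z, unfolded mult_1_left])
  also have "\<dots> = 1 + z * (\<Sum>k\<le>K. of_nat (u (p, q) (Suc k)) * z ^ k)
      + z * (\<Sum>k\<le>K. of_nat (u (p, q) k) * z ^ k)"
    using path_poly_eq[OF assms, of z] path_poly_eq_Suc[of p q K z] assms by simp
  also have "\<dots> = 1 + z * (\<Sum>k\<le>K. (of_nat (u (p, q) (Suc k)) + of_nat (u (p, q) k)) * z ^ k)"
    by (simp only: distrib_right sum.distrib distrib_left add.assoc)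
  finally show ?thesis .
qed

lemma path_poly_Suc_Suc:
  "path_poly (Suc p) (Suc q) z
     = (1 + z) * (path_poly p (Suc q) z + path_poly (Suc p) q z - path_poly p q z)"
proof -
  \<comment> \<open>\<open>K\<close> bounds the degrees of the three polynomials on the right; the
    one on the left has degree at most \<open>Suc K\<close>, which \<open>path_poly_eq_Suc\<close>
    allows.\<close>
  define K where "K = Suc (p + q)"
  have *: "of_nat (u (Suc p, Suc q) (Suc k)) = 
      (of_nat (u (p, Suc q) (Suc k)) + of_nat (u (p, Suc q) k))
      + (of_nat (u (Suc p, q) (Suc k)) + of_nat (u (Suc p, q) k))
      - (of_nat (u (p, q) (Suc k)) + of_nat (u (p, q) k) :: complex)" for k
    using arg_cong[OF u_Suc_Suc_Suc[of p q k], of "of_nat :: nat \<Rightarrow> complex"]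
    by (simp add: algebra_simps)
  have "path_poly (Suc p) (Suc q) z = 1 + z * (\<Sum>k\<le>K. of_nat (u (Suc p, Suc q) (Suc k)) * z ^ k)"
    by (intro path_poly_eq_Suc) (simp add: K_def)
  also have "\<dots> = (1 + z) * path_poly p (Suc q) z + (1 + z) * path_poly (Suc p) q z
      - (1 + z) * path_poly p q z"
  proof -
    have K: "p + Suc q \<le> K" "Suc p + q \<le> K" "p + q \<le> K"
      by (auto simp: K_def)
    show ?thesis
      unfolding * path_poly_add[OF K(1)] path_poly_add[OF K(2)] path_poly_add[OF K(3)]
        left_diff_distrib distrib_right[of "_ + _" "_ + _"] sum.distrib sum_subtractf
        distrib_left right_diff_distrib
      by (simp only: diff_conv_add_uminus minus_add ac_simps add_left_cancel) simp
  qed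
  finally show ?thesis by (simp only: distrib_left right_diff_distrib)
qed

lemma path_poly_zero_right: "path_poly p 0 z = (1 + z) ^ p"
proof (induction p)
  case (Suc p)
  have "path_poly (Suc p) 0 z = (1 + z) * path_poly p 0 z"
    by (subst path_poly_eq_Suc[of _ _ p], simp, subst path_poly_add[of _ _ p])
       (auto simp: u_Suc_zero_Suc)
  with Suc show ?case by simp
qed (simp add: path_poly_def)

lemma path_poly_commute: "path_poly p q z = path_poly q p z"
  by (simp add: path_poly_def u_commute[of p q] add.commute)

section \<open>Closed form of the generating polynomial\<close>

definition path_sum :: "nat \<Rightarrow> nat \<Rightarrow> complex \<Rightarrow> complex" where
  "path_sum p q z = (\<Sum>j\<le>min p q. of_nat (p choose j) * of_nat (q choose j) * z ^ j * (1 + z) ^ (p + q - j))"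

lemma path_sum_eq:
  assumes "min p q \<le> K"
  shows "path_sum p q z =
    (\<Sum>j\<le>K. of_nat (p choose j) * of_nat (q choose j) * z ^ j * (1 + z) ^ (p + q - j))"
  unfolding path_sum_def using assms
  by (intro sum.mono_neutral_left) (auto simp: min_def not_le split: if_splits)

text \<open>By Pascal's rule the mixed difference of \<open>(p choose j) * (q choose j)\<close> in
  \<open>p\<close> and \<open>q\<close> is the same product at \<open>j - 1\<close>. Shifting the
  index back then trades a factor \<open>1 + z\<close> for \<open>z\<close>.\<close>

lemma path_sum_Suc_Suc:
  "path_sum (Suc p) (Suc q) z
     = (1 + z) * (path_sum p (Suc q) z + path_sum (Suc p) q z - path_sum p q z)"
proof -
  define K s where "K = Suc (p + q)" and "s = 1 + z"
  \<comment> \<open>\<open>r\<close> gives all four sums the common exponent \<open>K - j\<close>: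
    the sum for \<open>(Suc p, Suc q)\<close> carries one factor \<open>s\<close> more, that for
    \<open>(p, q)\<close> one less.\<close>
  define r where "r j = z ^ j * s ^ (K - j)" for j
  define f where "f a b = (\<Sum>j\<le>K. of_nat (a choose j) * of_nat (b choose j) * r j)" for a b
  have K: "min (Suc p) (Suc q) \<le> K" "min p q \<le> K"
    by (auto simp: K_def)
  have f1: "path_sum (Suc p) (Suc q) z = s * f (Suc p) (Suc q)"
    unfolding path_sum_eq[OF K(1)] f_def sum_distrib_left
    by (intro sum.cong) (auto simp: K_def r_def s_def Suc_diff_le)
  have f2: "path_sum p (Suc q) z = f p (Suc q)"
    unfolding f_def by (subst path_sum_eq[of _ _ K]) (auto simp: K_def r_def s_def mult.assoc)
  have f3: "path_sum (Suc p) q z = f (Suc p) q"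
    unfolding f_def by (subst path_sum_eq[of _ _ K]) (auto simp: K_def r_def s_def mult.assoc)
  have f4: "s * path_sum p q z = f p q"
    unfolding path_sum_eq[OF K(2)] f_def sum_distrib_left
  proof (intro sum.cong refl)
    fix j assume "j \<in> {..K}"
    \<comment> \<open>At \<open>j = K\<close> the powers of \<open>s\<close> disagree, since
      subtraction on the naturals stops at zero, but \<open>p choose K\<close> vanishes.\<close>
    then consider "j \<le> p + q" | "j = K"
      by (force simp: K_def)
    then show "s * (of_nat (p choose j) * of_nat (q choose j) * z ^ j * (1 + z) ^ (p + q - j))
        = of_nat (p choose j) * of_nat (q choose j) * r j"
      by cases (simp_all add: K_def r_def s_def Suc_diff_le)
  qed
  have "f (Suc p) (Suc q) - f p (Suc q) - f (Suc p) q + f p q =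
    (\<Sum>j\<le>K. (of_nat (Suc p choose j) - of_nat (p choose j)) * (of_nat (Suc q choose j) - of_nat (q choose j)) * r j)"
    unfolding f_def by (simp add: algebra_simps sum.distrib sum_subtractf)
  also have "\<dots> = (\<Sum>j\<le>p+q. of_nat (p choose j) * of_nat (q choose j) * r (Suc j))"
    unfolding K_def by (subst sum.atMost_Suc_shift) simp
  finally have "s * (f (Suc p) (Suc q) - f p (Suc q) - f (Suc p) q + f p q)
      = (\<Sum>j\<le>p+q. of_nat (p choose j) * of_nat (q choose j) * (s * r (Suc j)))"
    by (simp add: sum_distrib_left mult_ac)
  also have "\<dots> = (\<Sum>j\<le>p+q. of_nat (p choose j) * of_nat (q choose j) * (z * r j))"
    by (intro sum.cong) (auto simp: r_def K_def Suc_diff_le)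
  also have "\<dots> = z * f p q"
    unfolding f_def K_def by (simp add: sum_distrib_left mult_ac binomial_eq_0)
  \<comment> \<open>Here \<open>s - z = 1\<close>, and \<open>f p q\<close> is \<open>s\<close>
    times \<open>path_sum p q z\<close>, which gives the recurrence.\<close>
  finally have "s * f (Suc p) (Suc q) = s * f p (Suc q) + s * f (Suc p) q - (s - z) * f p q"
    by (simp add: algebra_simps)
  then show ?thesis
    by (simp add: f1 f2 f3 f4[symmetric] s_def[symmetric] ring_distribs)
      (simp add: s_def algebra_simps)
qed

text \<open>Both sides obey the same recurrence and agree when \<open>p\<close> or \<open>q\<close>
  is zero, where they are a power of \<open>1 + z\<close>.\<close>

lemma path_poly_eq_path_sum:
  "path_poly p q z = path_sum p q z"
proof (induction "p + q" arbitrary: p q rule: less_induct)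
  case less
  show ?case
  proof (cases p)
    case 0
    then show ?thesis by (simp add: path_poly_commute[of 0] path_poly_zero_right path_sum_def)
  next
    case p: (Suc p')
    show ?thesis
    proof (cases q)
      case 0
      then show ?thesis by (simp add: path_poly_zero_right path_sum_def)
    next
      case (Suc q')
      with p less show ?thesis
        by (simp add: path_poly_Suc_Suc path_sum_Suc_Suc)
    qed
  qed
qed


section \<open>Elementary estimates for the exponential, the cosine and \<open>cis\<close>\<close>

lemma abs_exp_minus_diff_le:
  fixes x y :: real
  assumes "0 \<le> x" "0 \<le> y"
  shows "\<bar>exp (- x) - exp (- y)\<bar> \<le> \<bar>x - y\<bar>"
proof -
  have *: "\<bar>exp (- x) - exp (- y)\<bar> \<le> \<bar>x - y\<bar>" if "0 \<le> x" "x \<le> y" for x y :: real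
  proof -
    have **: "1 - exp (- (y - x)) \<le> y - x"
      using exp_ge_add_one_self[of "- (y - x)"] by linarith
    have "exp (- x) - exp (- y) = exp (- x) * (1 - exp (- (y - x)))"
      by (simp add: right_diff_distrib mult_exp_exp)
    also have "\<dots> \<le> 1 * (y - x)"
      using that by (intro mult_mono **) auto
    finally show ?thesis using that by simp
  qed
  show ?thesis
    using *[of x y] *[of y x] assms by (cases "x \<le> y") (auto simp: abs_minus_commute)
qed

text \<open>Both functions agree with \<open>1 - t^2 / 2\<close> up to errors
  \<open>t^4 / 24\<close> and \<open>t^4 / 4\<close>. The cosine will enter as the characteristic
  function of a fair sign, from the binomial part of the length.\<close>

lemma abs_cos_minus_exp_le: "\<bar>cos t - exp (- (t\<^sup>2 / 2))\<bar> \<le> t ^ 4" for t :: real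
proof -
  have "\<bar>cos t - 1 + t\<^sup>2 / 2\<bar> = \<bar>Re (iexp t - (\<Sum>k\<le>3. (\<i> * t) ^ k / fact k))\<bar>"
    by (simp add: numeral_3_eq_3 power2_eq_square cis_conv_exp[symmetric] fact_numeral)
  also have "\<dots> \<le> \<bar>t\<bar> ^ Suc 3 / fact (Suc 3)"
    by (rule order_trans[OF abs_Re_le_cmod iexp_approx1])
  finally have 1: "\<bar>cos t - 1 + t\<^sup>2 / 2\<bar> \<le> t ^ 4 / 24"
    by (simp add: fact_numeral eval_nat_numeral abs_mult)
  define x where "x = t\<^sup>2 / 2"
  have x: "0 \<le> x" "x\<^sup>2 = t ^ 4 / 4"
    by (simp_all add: x_def power_divide flip: power_mult)
  \<comment> \<open>The upper bound on \<open>exp (- x)\<close> is obtained after multiplying by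
    \<open>1 + x\<close>, using \<open>(1 - x + x^2) * (1 + x) = 1 + x^3\<close>.\<close>
  have "exp (- x) * (1 + x) \<le> exp (- x) * exp x"
    by (intro mult_left_mono exp_ge_add_one_self) auto
  also have "\<dots> = 1"
    by (simp flip: exp_add)
  also have "1 \<le> (1 - x + x\<^sup>2) * (1 + x)"
    using x(1) by (simp add: algebra_simps power2_eq_square)
  finally have "exp (- x) \<le> 1 - x + x\<^sup>2"
    using x(1) by simp
  moreover have "1 - x \<le> exp (- x)"
    using exp_ge_add_one_self[of "- x"] by simp
  ultimately show ?thesis
    using 1 x(2) zero_le_even_power[of 4 t] unfolding x_def[symmetric] by (simp only: abs_le_iff) linarith
qed

lemma norm_cis_minus_one_le: "norm (cis t - 1) \<le> \<bar>t\<bar>"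
  using iexp_approx1[of t 0] by (simp add: cis_conv_exp)

lemma norm_cis_minus_linear_le: "norm (cis t - 1 - \<i> * t) \<le> t\<^sup>2 / 2"
  using iexp_approx1[of t 1] by (simp add: cis_conv_exp diff_diff_eq power2_eq_square)

text \<open>The half-angle form splits \<open>1 + z\<close> on the unit circle into a real factor
  and a phase, so that its powers become powers of a cosine.\<close>

lemma one_plus_cis: "1 + cis t = of_real (2 * cos (t / 2)) * cis (t / 2)"
proof -
  have "cos t = 2 * cos (t / 2) ^ 2 - 1" "sin t = 2 * sin (t / 2) * cos (t / 2)"
    using cos_double_cos[of "t / 2"] sin_double[of "t / 2"] by auto
  then show ?thesis
    by (simp add: complex_eq_iff power2_eq_square)
qed

section \<open>The weights of \<open>J\<close> and the balance point \<open>a\<close>\<close>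

locale jump_start =
  fixes p q :: nat
  assumes pos: "0 < p + q"
begin

definition N :: real where "N = real p + real q"
text \<open>This is the square root that occurs in \<open>mu_pq\<close> and
  \<open>sigma2_pq\<close>.\<close>

definition R :: real where "R = sqrt (N\<^sup>2 + 4 * real p * real q)"
definition a :: real where "a = (R - N) / 2"
text \<open>Variance of the Gaussian approximating \<open>J - a\<close>: to leading order the
  identity for \<open>cis\<close> reads \<open>R * phi' = - 2 * a^2 * t * phi\<close>.\<close>

definition v :: real where "v = 2 * a\<^sup>2 / R"
text \<open>The summand of \<open>path_sum p q 1\<close>, divided by
  \<open>2 ^ (p + q)\<close>.\<close>

definition w :: "nat \<Rightarrow> real" where "w j = real (p choose j) * real (q choose j) / 2 ^ j"
definition W :: real where "W = (\<Sum>j\<le>min p q. w j)"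
definition prb :: "nat \<Rightarrow> real" where "prb j = w j / W"
definition dev :: "nat \<Rightarrow> real" where "dev j = real j - a"

lemma N_pos: "0 < N"
  using pos by (simp add: N_def flip: of_nat_add)

lemma R_sq: "R\<^sup>2 = N\<^sup>2 + 4 * real p * real q"
  by (simp add: R_def)

lemma R_ge: "N \<le> R"
  unfolding R_def by (intro real_le_rsqrt) simp

lemma R_pos: "0 < R"
  using N_pos R_ge by linarith

lemma four_pq_le: "4 * real p * real q \<le> N\<^sup>2"
proof -
  have "N\<^sup>2 - 4 * real p * real q = (real p - real q)\<^sup>2"
    by (simp add: N_def power2_eq_square algebra_simps)
  then show ?thesis
    using zero_le_power2[of "real p - real q"] by linarith
qed

lemma R_le: "R \<le> 2 * N"
proof (rule power2_le_imp_le)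
  have "R\<^sup>2 \<le> 4 * N\<^sup>2"
    using R_sq four_pq_le zero_le_power2[of N] by linarith
  then show "R\<^sup>2 \<le> (2 * N)\<^sup>2"
    by (simp add: power_mult_distrib)
qed (use N_pos in auto)

lemma a_nonneg: "0 \<le> a" and a_le: "a \<le> N"
  using R_ge R_le N_pos by (auto simp: a_def)

lemma a_root: "a\<^sup>2 + N * a = real p * real q"
  using R_sq by (simp add: a_def power2_eq_square field_simps)

lemma R_eq: "R = 2 * a + N"
  by (simp add: a_def field_simps)

lemma v_nonneg: "0 \<le> v"
  using R_pos by (simp add: v_def)

lemma index_le_N: "j \<le> min p q \<Longrightarrow> real j \<le> N"
  by (simp add: N_def)

lemma w_pos: "j \<le> min p q \<Longrightarrow> 0 < w j"
  by (simp add: w_def zero_less_binomial)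

lemma W_pos: "0 < W"
  unfolding W_def by (intro sum_pos) (auto simp: w_pos)

lemma prb_nonneg: "0 \<le> prb j"
  using W_pos by (simp add: prb_def w_def)

lemma sum_prb: "(\<Sum>j\<le>min p q. prb j) = 1"
  using W_pos by (simp add: prb_def W_def flip: sum_divide_distrib)

section \<open>Stein identity and moments of \<open>J\<close>\<close>

lemma w_Suc:
  assumes "j < min p q"
  shows "w j * ((real p - real j) * (real q - real j)) = w (Suc j) * (2 * (real (Suc j))\<^sup>2)"
proof -
  have *: "real (n choose j) * (real n - real j) = real (n choose Suc j) * real (Suc j)" if "j < n" for n
  proof -
    have "real (Suc j * (n choose Suc j)) = real ((n - j) * (n choose j))"
      by (simp only: binomial_absorption binomial_absorb_comp)
    then show ?thesis
      using that by (simp add: of_nat_diff algebra_simps)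
  qed
  have "w j * ((real p - real j) * (real q - real j))
      = (real (p choose j) * (real p - real j)) * (real (q choose j) * (real q - real j)) / 2 ^ j"
    by (simp add: w_def)
  also have "\<dots> = w (Suc j) * (2 * (real (Suc j))\<^sup>2)"
    using assms by (subst (1 2) *) (auto simp: w_def power2_eq_square)
  finally show ?thesis .
qed

text \<open>Shifting the index in \<open>w_Suc\<close> costs nothing at the ends:
  \<open>p - j\<close> or \<open>q - j\<close> vanishes at \<open>j = min p q\<close>, and
  \<open>j^2\<close> vanishes at \<open>j = 0\<close>. Vector values serve both the real choice
  \<open>dev\<close> and the complex choice \<open>cis\<close>.\<close>

lemma stein_identity:
  fixes g :: "nat \<Rightarrow> 'a::real_vector"
  shows "(\<Sum>j\<le>min p q. (prb j * ((real p - real j) * (real q - real j))) *\<^sub>R g (Suc j))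
    = (\<Sum>j\<le>min p q. (prb j * (2 * (real j)\<^sup>2)) *\<^sub>R g j)"
proof -
  define m where "m = min p q"
  have "prb m * ((real p - real m) * (real q - real m)) = 0"
    by (auto simp: m_def min_def)
  moreover have "{..m} = insert m {..<m}"
    by auto
  ultimately have "(\<Sum>j\<le>m. (prb j * ((real p - real j) * (real q - real j))) *\<^sub>R g (Suc j))
    = (\<Sum>j<m. (prb j * ((real p - real j) * (real q - real j))) *\<^sub>R g (Suc j))"
    by simp
  also have "\<dots> = (\<Sum>j<m. (prb (Suc j) * (2 * (real (Suc j))\<^sup>2)) *\<^sub>R g (Suc j))"
    by (intro sum.cong refl arg_cong2[of _ _ _ _ "(*\<^sub>R)"])
      (use w_Suc in \<open>simp add: prb_def m_def\<close>)
  also have "\<dots> = (\<Sum>j\<le>m. (prb j * (2 * (real j)\<^sup>2)) *\<^sub>R g j)"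
    by (subst sum.atMost_shift) simp
  finally show ?thesis by (simp add: m_def)
qed

text \<open>Expansion about \<open>a\<close>: \<open>a_root\<close> removes the constant term, and
  the slope \<open>2 * a + N\<close> is \<open>R\<close>.\<close>

lemma drift_eq: "2 * (real j)\<^sup>2 - (real p - real j) * (real q - real j) = (dev j)\<^sup>2 + R * dev j"
  using a_root unfolding R_eq dev_def N_def by (simp add: algebra_simps power2_eq_square)

text \<open>The value at \<open>a\<close> is \<open>2 * a^2\<close>, the numerator of
  \<open>v\<close>; the remainder is small on average by \<open>first_moment\<close>.\<close>

lemma product_eq: "(real p - real j) * (real q - real j) = 2 * a\<^sup>2 + dev j * (real j + a - N)"
  using a_root unfolding dev_def N_def by (simp add: algebra_simps power2_eq_square)

lemma second_moment: "(\<Sum>j\<le>min p q. prb j * (dev j)\<^sup>2) \<le> N / 4"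
proof -
  have "N * (\<Sum>j\<le>min p q. prb j * (dev j)\<^sup>2) = (\<Sum>j\<le>min p q. prb j * (N * (dev j)\<^sup>2))"
    by (simp add: sum_distrib_left mult_ac)
  also have "\<dots> \<le> (\<Sum>j\<le>min p q. prb j * (((dev j)\<^sup>2 + R * dev j) * dev j))"
  proof (intro sum_mono mult_left_mono prb_nonneg)
    fix j
    have "((dev j)\<^sup>2 + R * dev j) * dev j - N * (dev j)\<^sup>2 = (real j + a) * (dev j)\<^sup>2"
      unfolding R_eq dev_def by (simp add: algebra_simps power2_eq_square)
    also have "\<dots> \<ge> 0"
      using a_nonneg by simp
    finally show "N * (dev j)\<^sup>2 \<le> ((dev j)\<^sup>2 + R * dev j) * dev j" by simp
  qed
  also have "\<dots> = (\<Sum>j\<le>min p q. prb j * (2 * (real j)\<^sup>2) * dev j)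
      - (\<Sum>j\<le>min p q. prb j * ((real p - real j) * (real q - real j)) * dev j)"
    unfolding drift_eq[symmetric] sum_subtractf[symmetric]
    by (intro sum.cong refl) (simp only: left_diff_distrib right_diff_distrib mult.assoc)
  also have "(\<Sum>j\<le>min p q. prb j * (2 * (real j)\<^sup>2) * dev j)
      = (\<Sum>j\<le>min p q. prb j * ((real p - real j) * (real q - real j)) * (dev j + 1))"
    using stein_identity[of dev] by (simp add: dev_def algebra_simps)
  also have "\<dots> - (\<Sum>j\<le>min p q. prb j * ((real p - real j) * (real q - real j)) * dev j)
      = (\<Sum>j\<le>min p q. prb j * ((real p - real j) * (real q - real j)))"
    unfolding sum_subtractf[symmetric] by (intro sum.cong refl) (simp add: distrib_left)
  also have "\<dots> \<le> (\<Sum>j\<le>min p q. prb j * (real p * real q))"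
    by (intro sum_mono mult_left_mono mult_mono prb_nonneg) auto
  also have "\<dots> = real p * real q"
    by (simp add: sum_prb flip: sum_distrib_right)
  also have "\<dots> \<le> N * (N / 4)"
    using four_pq_le by (simp add: power2_eq_square)
  finally show ?thesis
    using N_pos by simp
qed

text \<open>A pointwise arithmetic-geometric mean inequality takes the place of Cauchy-Schwarz; the
  sum is at most \<open>N / 2\<close>, bounded generously by \<open>N\<close>.\<close>

lemma first_moment: "(\<Sum>j\<le>min p q. prb j * \<bar>dev j\<bar>) \<le> sqrt N"
proof -
  define c where "c = sqrt N"
  have c: "0 < c" "N = c * c"
    using N_pos by (simp_all add: c_def)
  have "c * (\<Sum>j\<le>min p q. prb j * \<bar>dev j\<bar>) = (\<Sum>j\<le>min p q. prb j * (c * \<bar>dev j\<bar>))"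
    by (simp add: sum_distrib_left mult_ac)
  also have "\<dots> \<le> (\<Sum>j\<le>min p q. prb j * ((dev j)\<^sup>2 + N / 4))"
  proof (intro sum_mono mult_left_mono prb_nonneg)
    fix j
    have "0 \<le> (\<bar>dev j\<bar> - c / 2)\<^sup>2"
      by simp
    also have "\<dots> = (dev j)\<^sup>2 + N / 4 - c * \<bar>dev j\<bar>"
      by (simp add: power2_diff c(2)) (simp add: power2_eq_square)
    finally show "c * \<bar>dev j\<bar> \<le> (dev j)\<^sup>2 + N / 4"
      by simp
  qed
  also have "\<dots> = (\<Sum>j\<le>min p q. prb j * (dev j)\<^sup>2) + (\<Sum>j\<le>min p q. prb j) * (N / 4)"
    by (simp only: distrib_left sum.distrib sum_distrib_right)
  also have "\<dots> \<le> c * c"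
    using second_moment N_pos c(2) by (simp add: sum_prb)
  finally show ?thesis
    using c(1) by (simp only: c_def[symmetric] mult_le_cancel_left_pos)
qed

section \<open>Characteristic function of the centred index \<open>J - a\<close>\<close>

definition phi :: "real \<Rightarrow> complex" where
  "phi t = (\<Sum>j\<le>min p q. prb j * cis (t * dev j))"

definition dphi :: "real \<Rightarrow> complex" where
  "dphi t = \<i> * (\<Sum>j\<le>min p q. prb j * cis (t * dev j) * dev j)"

lemma norm_phi_le: "norm (phi t) \<le> 1"
  unfolding phi_def
  by (rule order_trans[OF norm_sum]) (simp add: norm_mult prb_nonneg sum_prb)

lemma phi_has_derivative: "(phi has_vector_derivative dphi t) (at t within A)"
  unfolding phi_def dphi_def sum_distrib_left
proof (rule has_vector_derivative_sum)
  fix j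
  have "((\<lambda>t. cis (t * dev j)) has_vector_derivative dev j *\<^sub>R (\<i> * cis (t * dev j))) (at t within A)"
    by (auto intro!: derivative_eq_intros simp: has_vector_derivative_def scaleR_conv_of_real)
  from has_vector_derivative_mult_right[OF this, of "of_real (prb j)"]
  show "((\<lambda>t. prb j * cis (t * dev j)) has_vector_derivative
      \<i> * (prb j * cis (t * dev j) * dev j)) (at t within A)"
    by (simp add: scaleR_conv_of_real mult_ac)
qed

text \<open>The Stein identity for \<open>cis\<close> expresses \<open>R * S0\<close> by
  \<open>(cis t - 1) * D - S2\<close>, where \<open>D\<close> is \<open>2 * a^2 * phi t\<close> plus
  \<open>S1\<close>. The linear part of \<open>cis t - 1\<close> yields the main term. The three
  errors come, in order, from \<open>S1\<close>, from the Taylor remainder of \<open>cis\<close>,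
  and from \<open>S2\<close>, after division by \<open>R \<ge> N\<close>.\<close>

lemma phi_ode: "norm (dphi t + v * t * phi t) \<le> \<bar>t\<bar> * sqrt N + N * t\<^sup>2 + 1 / 4"
proof -
  let ?f = "\<lambda>j. prb j * cis (t * dev j)"
  define S0 where "S0 = (\<Sum>j\<le>min p q. ?f j * of_real (dev j))"
  define S1 where "S1 = (\<Sum>j\<le>min p q. ?f j * of_real (dev j * (real j + a - N)))"
  define S2 where "S2 = (\<Sum>j\<le>min p q. ?f j * of_real ((dev j)\<^sup>2))"
  define D where "D = (\<Sum>j\<le>min p q. ?f j * of_real ((real p - real j) * (real q - real j)))"
  have cis_Suc: "cis (t * dev (Suc j)) = cis t * cis (t * dev j)" for j
    by (simp add: dev_def cis_mult algebra_simps)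
  have "cis t * D = (\<Sum>j\<le>min p q. ?f j * of_real (2 * (real j)\<^sup>2))"
    using stein_identity[of "\<lambda>j. cis (t * dev j)"] unfolding D_def cis_Suc
    by (simp add: scaleR_conv_of_real sum_distrib_left mult_ac)
  then have "(cis t - 1) * D = (\<Sum>j\<le>min p q. ?f j * of_real (2 * (real j)\<^sup>2)) - D"
    by (simp add: left_diff_distrib)
  also have "\<dots> = (\<Sum>j\<le>min p q. ?f j * of_real (2 * (real j)\<^sup>2 - (real p - real j) * (real q - real j)))"
    unfolding D_def sum_subtractf[symmetric]
    by (intro sum.cong refl) (simp only: of_real_diff right_diff_distrib)
  also have "\<dots> = S2 + R * S0"
    unfolding drift_eq S2_def S0_def
    by (simp add: distrib_left sum.distrib sum_distrib_left mult_ac)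
  finally have RS0: "R * S0 = (cis t - 1) * D - S2"
    by simp
  have D_eq: "D = 2 * a\<^sup>2 * phi t + S1"
    unfolding D_def product_eq phi_def S1_def
    by (simp add: distrib_left sum.distrib sum_distrib_left mult_ac)
  have "R * (dphi t + v * t * phi t) = \<i> * (R * S0) + 2 * a\<^sup>2 * t * phi t"
    using R_pos by (simp add: dphi_def S0_def v_def algebra_simps)
  also have "\<dots> = \<i> * ((cis t - 1 - \<i> * t) * (2 * a\<^sup>2 * phi t) + (cis t - 1) * S1 - S2)"
    unfolding RS0 D_eq by (simp add: algebra_simps)
  finally have "norm (R * (dphi t + v * t * phi t))
      = norm ((cis t - 1 - \<i> * t) * (2 * a\<^sup>2 * phi t) + (cis t - 1) * S1 - S2)"
    by (simp only: norm_mult norm_ii mult_1_left)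
  also have "\<dots> \<le> norm (cis t - 1 - \<i> * t) * norm (2 * a\<^sup>2 * phi t) + norm (cis t - 1) * norm S1 + norm S2"
    by (intro order_trans[OF norm_triangle_ineq4] add_mono order_trans[OF norm_triangle_ineq])
      (simp_all add: norm_mult)
  also have "\<dots> \<le> t\<^sup>2 / 2 * (2 * N\<^sup>2) + \<bar>t\<bar> * (N * sqrt N) + N / 4"
  proof (intro add_mono mult_mono norm_cis_minus_one_le norm_cis_minus_linear_le)
    have "a\<^sup>2 * norm (phi t) \<le> N\<^sup>2 * 1"
      using a_nonneg a_le norm_phi_le by (intro mult_mono power_mono) auto
    then show "norm (2 * a\<^sup>2 * phi t) \<le> 2 * N\<^sup>2"
      by (simp add: norm_mult norm_power)
    have "norm S1 \<le> (\<Sum>j\<le>min p q. N * (prb j * \<bar>dev j\<bar>))"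
      unfolding S1_def
    proof (rule sum_norm_le)
      fix j assume "j \<in> {..min p q}"
      then have "\<bar>real j + a - N\<bar> \<le> N"
        using a_nonneg a_le index_le_N[of j] by auto
      then have "prb j * \<bar>dev j\<bar> * \<bar>real j + a - N\<bar> \<le> prb j * \<bar>dev j\<bar> * N"
        by (intro mult_left_mono) (auto simp: prb_nonneg)
      moreover have "norm (?f j * of_real (dev j * (real j + a - N))) = prb j * \<bar>dev j\<bar> * \<bar>real j + a - N\<bar>"
        by (simp only: norm_mult norm_cis norm_of_real abs_mult) (simp add: prb_nonneg)
      ultimately show "norm (?f j * of_real (dev j * (real j + a - N))) \<le> N * (prb j * \<bar>dev j\<bar>)"
        by (simp add: mult_ac)
    qed
    also have "\<dots> \<le> N * sqrt N"
      unfolding sum_distrib_left[symmetric] using N_pos by (intro mult_left_mono first_moment) auto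
    finally show "norm S1 \<le> N * sqrt N" .
    have "norm S2 \<le> (\<Sum>j\<le>min p q. prb j * (dev j)\<^sup>2)"
      unfolding S2_def by (intro sum_norm_le) (simp add: norm_mult norm_power prb_nonneg)
    then show "norm S2 \<le> N / 4"
      using second_moment by linarith
  qed auto
  also have "\<dots> = N * (\<bar>t\<bar> * sqrt N + N * t\<^sup>2 + 1 / 4)"
    by (simp add: algebra_simps power2_eq_square)
  also have "\<dots> \<le> R * (\<bar>t\<bar> * sqrt N + N * t\<^sup>2 + 1 / 4)"
    using N_pos R_ge by (intro mult_right_mono) auto
  finally show ?thesis
    using R_pos by (simp add: norm_mult)
qed

text \<open>With the integrating factor \<open>g\<close>, the derivative of \<open>g * phi\<close>
  is \<open>g\<close> times the error in \<open>phi_ode\<close>. On the segment from 0 to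
  \<open>t\<close>, of either sign, \<open>g\<close> is largest at \<open>t\<close>, and dividing by
  \<open>g t\<close> cancels it.\<close>

lemma phi_approx:
  "norm (phi t - of_real (exp (- (v * t\<^sup>2 / 2)))) \<le> \<bar>t\<bar> * (\<bar>t\<bar> * sqrt N + N * t\<^sup>2 + 1 / 4)"
proof -
  define B where "B = \<bar>t\<bar> * sqrt N + N * t\<^sup>2 + 1 / 4"
  define g where "g s = exp (v * s\<^sup>2 / 2)" for s :: real
  have g_pos: "0 < g s" for s
    by (simp add: g_def)
  have g: "(g has_real_derivative v * s * g s) (at s within A)" for s A
    unfolding g_def by (auto intro!: derivative_eq_intros)
  have deriv: "((\<lambda>s. g s *\<^sub>R phi s) has_vector_derivative g s *\<^sub>R (dphi s + v * s * phi s)) (at s within A)" for s A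
  proof -
    have "g s *\<^sub>R dphi s + (v * s * g s) *\<^sub>R phi s = g s *\<^sub>R (dphi s + v * s * phi s)"
      by (simp add: scaleR_conv_of_real distrib_left mult_ac)
    then show ?thesis
      using has_vector_derivative_scaleR[OF g phi_has_derivative, of s A] by simp
  qed
  have "norm (g t *\<^sub>R phi t - g 0 *\<^sub>R phi 0) \<le> g t * B * norm (t - 0)"
  proof (rule differentiable_bound[where S = "closed_segment 0 t"])
    fix s assume s: "s \<in> closed_segment 0 t"
    then have "\<bar>s\<bar> \<le> \<bar>t\<bar>"
      by (auto simp: closed_segment_eq_real_ivl split: if_splits)
    then have "s\<^sup>2 \<le> t\<^sup>2"
      by (simp add: abs_le_square_iff)
    have "norm (dphi s + v * s * phi s) \<le> \<bar>s\<bar> * sqrt N + N * s\<^sup>2 + 1 / 4"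
      by (rule phi_ode)
    also have "\<dots> \<le> B"
      unfolding B_def using \<open>\<bar>s\<bar> \<le> \<bar>t\<bar>\<close> \<open>s\<^sup>2 \<le> t\<^sup>2\<close> N_pos
      by (intro add_mono mult_right_mono mult_left_mono) auto
    finally have le: "norm (dphi s + v * s * phi s) \<le> B" .
    have "g s \<le> g t"
      unfolding g_def exp_le_cancel_iff using \<open>s\<^sup>2 \<le> t\<^sup>2\<close> v_nonneg
      by (intro divide_right_mono mult_left_mono) auto
    then have "g s * norm (dphi s + v * s * phi s) \<le> g t * B"
      using le g_pos[of t] by (intro mult_mono) (auto intro: less_imp_le)
    then have "norm (g s *\<^sub>R (dphi s + v * s * phi s)) \<le> g t * B"
      using g_pos[of s] by (simp only: norm_scaleR abs_of_pos)
    then show "onorm (\<lambda>h. h *\<^sub>R (g s *\<^sub>R (dphi s + v * s * phi s))) \<le> g t * B"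
    proof (intro onorm_le)
      fix h :: real
      assume "norm (g s *\<^sub>R (dphi s + v * s * phi s)) \<le> g t * B"
      from mult_left_mono[OF this abs_ge_zero[of h]]
      show "norm (h *\<^sub>R (g s *\<^sub>R (dphi s + v * s * phi s))) \<le> g t * B * norm h"
        unfolding norm_scaleR[of h] real_norm_def by (subst mult.commute[of "g t * B"])
    qed
    show "((\<lambda>s. g s *\<^sub>R phi s) has_derivative (\<lambda>h. h *\<^sub>R (g s *\<^sub>R (dphi s + v * s * phi s))))
        (at s within closed_segment 0 t)"
      using deriv unfolding has_vector_derivative_def .
  qed auto
  moreover have "phi 0 = 1" "g 0 = 1"
    by (simp_all add: phi_def g_def sum_prb flip: of_real_sum)
  ultimately have bound: "norm (g t * phi t - 1) \<le> g t * B * \<bar>t\<bar>"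
    by (simp add: scaleR_conv_of_real)
  have "exp (- (v * t\<^sup>2 / 2)) = 1 / g t"
    by (simp only: g_def exp_minus inverse_eq_divide)
  then have "phi t - of_real (exp (- (v * t\<^sup>2 / 2))) = (g t * phi t - 1) / g t"
    using g_pos[of t] by (simp add: diff_divide_distrib)
  then have "norm (phi t - of_real (exp (- (v * t\<^sup>2 / 2)))) = norm (g t * phi t - 1) / g t"
    using g_pos[of t] by (simp only: norm_divide norm_of_real abs_of_pos)
  also have "\<dots> \<le> g t * B * \<bar>t\<bar> / g t"
    by (intro divide_right_mono bound less_imp_le[OF g_pos])
  also have "\<dots> = \<bar>t\<bar> * B"
    using g_pos[of t] by simp
  finally show ?thesis
    by (simp only: B_def)
qed

section \<open>Mean, variance and characteristic function of the path length\<close>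

lemma mu_eq: "mu_pq p q = (N + a) / 2"
  and sigma2_eq: "sigma2_pq p q = (N - a) / 4 + v / 4"
proof -
  have "N\<^sup>2 + 4 * real p * real q = (real p)\<^sup>2 + 6 * real p * real q + (real q)\<^sup>2"
    by (simp add: N_def power2_eq_square algebra_simps)
  then have R: "sqrt ((real p)\<^sup>2 + 6 * real p * real q + (real q)\<^sup>2) = R"
    by (simp add: R_def)
  \<comment> \<open>Given \<open>J\<close>, the length has mean \<open>(N + J) / 2\<close>; this is
    its value at \<open>J = a\<close>.\<close>
  show "mu_pq p q = (N + a) / 2"
    unfolding mu_pq_def R by (simp add: a_def N_def field_simps)
  \<comment> \<open>Total variance: the binomial part contributes \<open>(N - a) / 4\<close>, and
    the mean \<open>(N + J) / 2\<close> contributes \<open>v / 4\<close>.\<close>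
  have "(N - a) / 4 + v / 4 = N / 8 + N\<^sup>2 / (8 * R)"
    unfolding v_def a_def using R_pos by (simp add: field_simps power2_eq_square)
  then show "sigma2_pq p q = (N - a) / 4 + v / 4"
    unfolding sigma2_pq_def R by (simp add: N_def)
qed

lemma sigma2_ge: "N / 8 \<le> sigma2_pq p q"
  unfolding sigma2_pq_def by (simp add: N_def)

text \<open>The quotient is the characteristic function of the length at \<open>2 * t\<close>,
  doubled so that half angles become \<open>t\<close>. The phases add up to
  \<open>2 * t * j + t * (N - j) - t * (N + a) = t * (j - a)\<close>.\<close>

lemma path_poly_cis:
  "path_poly p q (cis (2 * t)) / path_poly p q 1 * cis (- (2 * t * mu_pq p q))
    = (\<Sum>j\<le>min p q. of_real (prb j * cos t ^ (p + q - j)) * cis (t * dev j))"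
proof -
  have pow2: "2 ^ (p + q - j) = (2 ^ (p + q) / 2 ^ j :: real)" if "j \<le> min p q" for j
    using that by (simp add: power_diff)
  have one: "path_poly p q 1 = of_real (2 ^ (p + q) * W)"
  proof -
    have "path_poly p q 1 = (\<Sum>j\<le>min p q. of_real (real (p choose j) * real (q choose j) * 2 ^ (p + q - j)))"
      by (simp add: path_poly_eq_path_sum path_sum_def)
    also have "\<dots> = (\<Sum>j\<le>min p q. of_real (2 ^ (p + q) * w j))"
      by (intro sum.cong refl arg_cong[of _ _ of_real]) (simp add: pow2 w_def)
    finally show ?thesis
      by (simp only: W_def sum_distrib_left of_real_sum)
  qed
  have "path_poly p q (cis (2 * t)) * cis (- (2 * t * mu_pq p q))
      = (\<Sum>j\<le>min p q. of_real (2 ^ (p + q) * (w j * cos t ^ (p + q - j))) * cis (t * dev j))"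
    unfolding path_poly_eq_path_sum path_sum_def sum_distrib_right
  proof (intro sum.cong refl)
    fix j assume j: "j \<in> {..min p q}"
    have "cis (2 * t) ^ j * (cis t ^ (p + q - j) * cis (- (2 * t * mu_pq p q))) = cis (t * dev j)"
      using j unfolding Complex.DeMoivre cis_mult mu_eq
      by (intro arg_cong[of _ _ cis]) (simp add: dev_def N_def of_nat_diff algebra_simps)
    moreover have "(1 + cis (2 * t)) ^ (p + q - j) = of_real (2 ^ (p + q - j) * cos t ^ (p + q - j)) * cis t ^ (p + q - j)"
      using one_plus_cis[of "2 * t"] by (simp add: power_mult_distrib)
    ultimately have "of_nat (p choose j) * of_nat (q choose j) * cis (2 * t) ^ j *
        (1 + cis (2 * t)) ^ (p + q - j) * cis (- (2 * t * mu_pq p q))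
        = of_real (real (p choose j) * real (q choose j) * (2 ^ (p + q - j) * cos t ^ (p + q - j)))
          * cis (t * dev j)"
      by (simp add: mult_ac)
    also have "real (p choose j) * real (q choose j) * (2 ^ (p + q - j) * cos t ^ (p + q - j))
        = 2 ^ (p + q) * (w j * cos t ^ (p + q - j))"
      using j by (simp add: pow2 w_def)
    finally show "of_nat (p choose j) * of_nat (q choose j) * cis (2 * t) ^ j *
        (1 + cis (2 * t)) ^ (p + q - j) * cis (- (2 * t * mu_pq p q))
      = of_real (2 ^ (p + q) * (w j * cos t ^ (p + q - j))) * cis (t * dev j)" .
  qed
  then have "path_poly p q (cis (2 * t)) / path_poly p q 1 * cis (- (2 * t * mu_pq p q))
      = (\<Sum>j\<le>min p q. of_real (2 ^ (p + q) * (w j * cos t ^ (p + q - j))) * cis (t * dev j))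
        / of_real (2 ^ (p + q) * W)"
    by (simp only: one times_divide_eq_left)
  also have "\<dots> = (\<Sum>j\<le>min p q. of_real (prb j * cos t ^ (p + q - j)) * cis (t * dev j))"
    unfolding sum_divide_distrib using W_pos by (intro sum.cong refl) (simp add: prb_def)
  finally show ?thesis .
qed

text \<open>The power of the cosine is replaced by a Gaussian factor, then \<open>j\<close> by
  \<open>a\<close> in its exponent. The resulting constant \<open>E\<close> leaves the sum, and what
  remains is \<open>phi t\<close>, close to \<open>G\<close>.\<close>

lemma path_poly_cis_approx:
  "norm (path_poly p q (cis (2 * t)) / path_poly p q 1 * cis (- (2 * t * mu_pq p q))
      - of_real (exp (- (2 * t\<^sup>2 * sigma2_pq p q))))
    \<le> N * t ^ 4 + t\<^sup>2 / 2 * sqrt N + \<bar>t\<bar> * (\<bar>t\<bar> * sqrt N + N * t\<^sup>2 + 1 / 4)"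
proof -
  define E where "E = exp (- (t\<^sup>2 / 2 * (N - a)))"
  define G where "G = exp (- (v * t\<^sup>2 / 2))"
  define c where "c j = cos t ^ (p + q - j)" for j
  have E: "0 \<le> E" "E \<le> 1"
    using a_le by (simp_all add: E_def)
  have EG: "exp (- (2 * t\<^sup>2 * sigma2_pq p q)) = E * G"
    unfolding E_def G_def mult_exp_exp sigma2_eq by (simp add: field_simps)
  have c_E: "\<bar>c j - E\<bar> \<le> N * t ^ 4 + t\<^sup>2 / 2 * \<bar>dev j\<bar>" if "j \<le> min p q" for j
  proof -
    have m: "real (p + q - j) = N - real j"
      using that by (simp add: N_def of_nat_diff)
    have "\<bar>c j - exp (- (t\<^sup>2 / 2)) ^ (p + q - j)\<bar> \<le> real (p + q - j) * \<bar>cos t - exp (- (t\<^sup>2 / 2))\<bar>"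
      unfolding c_def using norm_power_diff[of "cos t" "exp (- (t\<^sup>2 / 2))" "p + q - j"] by simp
    also have "\<dots> \<le> N * t ^ 4"
      using N_pos by (intro mult_mono abs_cos_minus_exp_le) (simp_all add: m)
    finally have 1: "\<bar>c j - exp (- (t\<^sup>2 / 2)) ^ (p + q - j)\<bar> \<le> N * t ^ 4" .
    have "exp (- (t\<^sup>2 / 2)) ^ (p + q - j) = exp (- (t\<^sup>2 / 2 * (N - real j)))"
      unfolding m[symmetric] by (simp add: exp_of_nat_mult[symmetric] mult_ac)
    then have "\<bar>exp (- (t\<^sup>2 / 2)) ^ (p + q - j) - E\<bar> \<le> \<bar>t\<^sup>2 / 2 * (N - real j) - t\<^sup>2 / 2 * (N - a)\<bar>"
      using index_le_N[OF that] a_le unfolding E_def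
      by (simp only:, intro abs_exp_minus_diff_le) (auto intro!: mult_nonneg_nonneg)
    also have "\<dots> = t\<^sup>2 / 2 * \<bar>dev j\<bar>"
      unfolding right_diff_distrib[symmetric] abs_mult dev_def by (simp add: abs_minus_commute)
    finally show ?thesis
      using 1 by linarith
  qed
  have split: "of_real (prb j * c j) * cis (t * dev j)
      = of_real (prb j * (c j - E)) * cis (t * dev j) + of_real E * (prb j * cis (t * dev j))" for j
    by (simp add: algebra_simps)
  have "path_poly p q (cis (2 * t)) / path_poly p q 1 * cis (- (2 * t * mu_pq p q)) - of_real (E * G)
      = (\<Sum>j\<le>min p q. of_real (prb j * (c j - E)) * cis (t * dev j)) + of_real E * (phi t - of_real G)"
    unfolding path_poly_cis c_def[symmetric] split phi_def sum.distrib
    by (simp only: sum_distrib_left[symmetric] of_real_mult right_diff_distrib add_diff_eq)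
  also have "norm \<dots> \<le> (\<Sum>j\<le>min p q. prb j * (N * t ^ 4 + t\<^sup>2 / 2 * \<bar>dev j\<bar>)) + 1 * norm (phi t - of_real G)"
  proof (intro order_trans[OF norm_triangle_ineq] add_mono sum_norm_le)
    fix j assume "j \<in> {..min p q}"
    then show "norm (of_real (prb j * (c j - E)) * cis (t * dev j)) \<le> prb j * (N * t ^ 4 + t\<^sup>2 / 2 * \<bar>dev j\<bar>)"
      using c_E[of j] by (simp only: norm_mult norm_cis norm_of_real abs_mult)
        (simp add: prb_nonneg mult_left_mono)
  next
    show "norm (of_real E * (phi t - of_real G)) \<le> 1 * norm (phi t - of_real G)"
      unfolding norm_mult using E by (intro mult_right_mono) auto
  qed
  also have "(\<Sum>j\<le>min p q. prb j * (N * t ^ 4 + t\<^sup>2 / 2 * \<bar>dev j\<bar>))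
      = (\<Sum>j\<le>min p q. prb j) * (N * t ^ 4) + t\<^sup>2 / 2 * (\<Sum>j\<le>min p q. prb j * \<bar>dev j\<bar>)"
    unfolding sum_distrib_left sum_distrib_right sum.distrib[symmetric]
    by (intro sum.cong refl) (simp only: distrib_left mult.left_commute)
  also have "\<dots> \<le> N * t ^ 4 + t\<^sup>2 / 2 * sqrt N"
    unfolding sum_prb by (intro add_mono mult_left_mono first_moment) auto
  finally show ?thesis
    using phi_approx[of t] unfolding EG G_def by linarith
qed

text \<open>In terms of \<open>r = \<bar>t\<bar> * sqrt N\<close>, every error term is a power of
  \<open>r\<close> divided by \<open>sqrt N\<close> or by \<open>N\<close>, and \<open>r\<close>
  stays bounded.\<close>

lemma standardized_approx:
  fixes \<theta> :: real
  defines "K \<equiv> sqrt 2 * \<bar>\<theta>\<bar>" and "s \<equiv> sqrt (sigma2_pq p q)"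
  shows "norm (path_poly p q (cis (\<theta> / s)) / path_poly p q 1 * cis (- (\<theta> / s * mu_pq p q))
      - of_real (exp (- \<theta>\<^sup>2 / 2))) \<le> (K ^ 4 + K ^ 2 / 2 + (K ^ 2 + K ^ 3 + K / 4)) / sqrt N"
proof -
  define t where "t = \<theta> / (2 * s)"
  define c where "c = sqrt N"
  define r where "r = \<bar>t\<bar> * c"
  have N1: "1 \<le> N"
    using pos unfolding N_def by linarith
  then have c: "1 \<le> c" "N = c\<^sup>2"
    by (simp_all add: c_def)
  have s2: "0 < s" "s\<^sup>2 = sigma2_pq p q"
    using sigma2_ge N_pos by (simp_all add: s_def)
  have "r\<^sup>2 = \<theta>\<^sup>2 / 4 * (N / s\<^sup>2)"
    by (simp add: r_def t_def power_mult_distrib power_divide c(2))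
  \<comment> \<open>The ratio \<open>N / s^2\<close> is at most 8 by \<open>sigma2_ge\<close>; this
    is the source of \<open>sqrt 2\<close> in \<open>K\<close>.\<close>
  also have "\<dots> \<le> \<theta>\<^sup>2 / 4 * 8"
    using sigma2_ge s2 N_pos by (intro mult_left_mono) (auto simp: divide_le_eq)
  also have "\<dots> = K\<^sup>2"
    by (simp add: K_def power_mult_distrib)
  finally have r_le: "r \<le> K"
    by (rule power2_le_imp_le) (simp add: K_def)
  have r0: "0 \<le> r"
    using c by (simp add: r_def)
  have t: "\<bar>t\<bar> = r / c"
    using c by (simp add: r_def)
  have \<theta>_s: "\<theta> / s = 2 * t"
    by (simp add: t_def)
  have \<theta>_sq: "- \<theta>\<^sup>2 / 2 = - (2 * t\<^sup>2 * sigma2_pq p q)"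
    using s2 by (simp add: t_def power_divide power_mult_distrib flip: s2(2))
  have "norm (path_poly p q (cis (\<theta> / s)) / path_poly p q 1 * cis (- (\<theta> / s * mu_pq p q))
      - of_real (exp (- \<theta>\<^sup>2 / 2)))
    \<le> N * t ^ 4 + t\<^sup>2 / 2 * sqrt N + \<bar>t\<bar> * (\<bar>t\<bar> * sqrt N + N * t\<^sup>2 + 1 / 4)"
    unfolding \<theta>_s \<theta>_sq by (rule path_poly_cis_approx)
  also have "\<dots> = N * \<bar>t\<bar> ^ 4 + \<bar>t\<bar> ^ 2 / 2 * c + \<bar>t\<bar> * (\<bar>t\<bar> * c + N * \<bar>t\<bar> ^ 2 + 1 / 4)"
    by (simp add: c_def)
  also have "\<dots> = r ^ 4 / c\<^sup>2 + (r ^ 2 / 2 + (r ^ 2 + r ^ 3 + r / 4)) / c"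
    unfolding t c(2) using c(1) by (simp add: field_simps eval_nat_numeral)
  also have "r ^ 4 / c\<^sup>2 \<le> r ^ 4 / c"
    using c(1) r0 by (intro divide_left_mono) (auto simp: power2_eq_square)
  also have "r ^ 4 / c + (r ^ 2 / 2 + (r ^ 2 + r ^ 3 + r / 4)) / c
      = (r ^ 4 + r ^ 2 / 2 + (r ^ 2 + r ^ 3 + r / 4)) / c"
    by (simp only: add_divide_distrib add.assoc)
  also have "\<dots> \<le> (K ^ 4 + K ^ 2 / 2 + (K ^ 2 + K ^ 3 + K / 4)) / c"
    using c(1) r0 r_le by (intro divide_right_mono add_mono power_mono) auto
  finally show ?thesis
    by (simp add: c_def)
qed

end

section \<open>The law of the path length as a probability measure\<close>

lemma path_poly_1: "path_poly p q 1 = of_real (\<Sum>k\<le>p + q. real (u (p, q) k))"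
  by (simp add: path_poly_def)

lemma sum_u_pos: "0 < (\<Sum>k\<le>p + q. real (u (p, q) k))"
  by (rule sum_pos2[of _ 0]) auto

lemma X_prob_eq: "X_prob p q k = real (u (p, q) k) / (\<Sum>j\<le>p + q. real (u (p, q) j))"
proof -
  have "(\<Sum>j. real (u (p, q) j)) = (\<Sum>j\<le>p + q. real (u (p, q) j))"
    by (intro suminf_finite) (auto simp: u_eq_0 not_le)
  then show ?thesis by (simp add: X_prob_def)
qed

lemma X_prob_eq_0: "p + q < k \<Longrightarrow> X_prob p q k = 0"
  by (simp add: X_prob_eq u_eq_0)

lemma X_prob_nonneg: "0 \<le> X_prob p q k"
  using sum_u_pos[of p q] by (simp add: X_prob_eq)

definition length_pmf :: "nat \<Rightarrow> nat \<Rightarrow> nat pmf" where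
  "length_pmf p q = embed_pmf (X_prob p q)"

lemma pmf_length_pmf: "pmf (length_pmf p q) k = X_prob p q k"
  unfolding length_pmf_def
proof (rule pmf_embed_pmf[OF X_prob_nonneg])
  have "(\<integral>\<^sup>+ k. ennreal (X_prob p q k) \<partial>count_space UNIV) = (\<Sum>k\<le>p + q. ennreal (X_prob p q k))"
    by (intro nn_integral_count_space') (auto simp: X_prob_eq_0 not_le)
  also have "\<dots> = ennreal (\<Sum>k\<le>p + q. X_prob p q k)"
    by (intro sum_ennreal X_prob_nonneg)
  also have "(\<Sum>k\<le>p + q. X_prob p q k) = 1"
    using sum_u_pos[of p q] by (simp add: X_prob_eq flip: sum_divide_distrib)
  finally show "(\<integral>\<^sup>+ k. ennreal (X_prob p q k) \<partial>count_space UNIV) = 1"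
    by simp
qed

lemma integral_length_pmf:
  fixes f :: "nat \<Rightarrow> 'a :: {banach, second_countable_topology}"
  shows "(\<integral>k. f k \<partial>length_pmf p q) = (\<Sum>k\<le>p + q. X_prob p q k *\<^sub>R f k)"
  unfolding pmf_length_pmf[symmetric]
  by (rule integral_measure_pmf) (auto simp: set_pmf_iff pmf_length_pmf X_prob_eq_0 simp flip: not_less)

definition std_length_distr :: "nat \<Rightarrow> nat \<Rightarrow> real measure" where
  "std_length_distr p q =
    distr (length_pmf p q) borel (\<lambda>k. (real k - mu_pq p q) / sqrt (sigma2_pq p q))"

text \<open>This covers \<open>(0, 0)\<close> too, where division by zero makes the standardized
  length constantly 0; Levy's theorem needs every member of the sequence to be a
  distribution.\<close>

lemma real_distribution_std_length: "real_distribution (std_length_distr p q)"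
  unfolding std_length_distr_def
  by (intro prob_space.real_distribution_distr measure_pmf.prob_space_axioms) simp

lemma cdf_std_length: "cdf (std_length_distr p q) x = X_std_cdf p q x"
proof -
  define f where "f k = (real k - mu_pq p q) / sqrt (sigma2_pq p q)" for k
  have "cdf (std_length_distr p q) x = measure (length_pmf p q) {k. f k \<le> x}"
    by (simp add: cdf_def std_length_distr_def measure_distr f_def vimage_def)
  also have "\<dots> = (\<integral>k. indicator {k. f k \<le> x} k \<partial>length_pmf p q)"
    by simp
  also have "\<dots> = (\<Sum>k\<le>p + q. if f k \<le> x then X_prob p q k else 0)"
    unfolding integral_length_pmf by (intro sum.cong) auto
  also have "\<dots> = (\<Sum>k. if f k \<le> x then X_prob p q k else 0)"
    by (rule suminf_finite[symmetric]) (auto simp: X_prob_eq_0 not_le)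
  finally show ?thesis
    by (simp add: X_std_cdf_def f_def)
qed

lemma char_std_length:
  fixes p q :: nat
  defines "s \<equiv> sqrt (sigma2_pq p q)"
  shows "char (std_length_distr p q) \<theta>
    = path_poly p q (cis (\<theta> / s)) / path_poly p q 1 * cis (- (\<theta> / s * mu_pq p q))"
proof -
  have "char (std_length_distr p q) \<theta>
      = (\<integral>k. iexp (\<theta> * ((real k - mu_pq p q) / s)) \<partial>length_pmf p q)"
    unfolding char_def std_length_distr_def s_def by (rule integral_distr) auto
  also have "\<dots> = (\<Sum>k\<le>p + q. X_prob p q k *\<^sub>R (cis (\<theta> / s) ^ k * cis (- (\<theta> / s * mu_pq p q))))"
    unfolding integral_length_pmf cis_conv_exp[symmetric] Complex.DeMoivre cis_mult
    by (intro sum.cong refl arg_cong2[of _ _ _ _ "(*\<^sub>R)"] arg_cong[of _ _ cis])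
      (simp add: diff_divide_distrib right_diff_distrib mult_ac)
  also have "\<dots> = path_poly p q (cis (\<theta> / s)) / path_poly p q 1 * cis (- (\<theta> / s * mu_pq p q))"
    unfolding path_poly_1 unfolding path_poly_def sum_distrib_right sum_divide_distrib X_prob_eq
    by (intro sum.cong refl) (simp add: scaleR_conv_of_real)
  finally show ?thesis .
qed

section \<open>Convergence to the normal law\<close>

lemma weak_conv_std_length: "weak_conv_m (\<lambda>n. std_length_distr n (Q n)) std_normal_distribution"
proof (rule levy_continuity[OF real_distribution_std_length real_dist_normal_dist])
  fix \<theta> :: real
  define K where "K = sqrt 2 * \<bar>\<theta>\<bar>"
  define C where "C = K ^ 4 + K ^ 2 / 2 + (K ^ 2 + K ^ 3 + K / 4)"
  have "0 \<le> C"
    by (simp add: C_def K_def)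
  have "norm (char (std_length_distr n (Q n)) \<theta> - of_real (exp (- \<theta>\<^sup>2 / 2))) \<le> C / sqrt (real n)"
    if "0 < n" for n
  proof -
    interpret jump_start n "Q n"
      by standard (use that in simp)
    have "norm (char (std_length_distr n (Q n)) \<theta> - of_real (exp (- \<theta>\<^sup>2 / 2))) \<le> C / sqrt N"
      unfolding char_std_length C_def K_def by (rule standardized_approx)
    \<comment> \<open>The bound depends on the starting point only through \<open>N\<close>, and
      \<open>N \<ge> n\<close> whatever \<open>Q n\<close> is.\<close>
    also have "\<dots> \<le> C / sqrt (real n)"
      using that \<open>0 \<le> C\<close> N_pos by (intro divide_left_mono mult_pos_pos) (simp_all add: N_def)
    finally show ?thesis .
  qed
  then have "\<forall>\<^sub>F n in sequentially.
      norm (char (std_length_distr n (Q n)) \<theta> - of_real (exp (- \<theta>\<^sup>2 / 2))) \<le> C / sqrt (real n)"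
    by (intro eventually_mono[OF eventually_gt_at_top[of 0]])
  moreover have "(\<lambda>n. C / sqrt (real n)) \<longlonglongrightarrow> 0"
    by real_asymp
  ultimately have "(\<lambda>n. char (std_length_distr n (Q n)) \<theta> - of_real (exp (- \<theta>\<^sup>2 / 2))) \<longlonglongrightarrow> 0"
    by (rule Lim_null_comparison)
  then show "(\<lambda>n. char (std_length_distr n (Q n)) \<theta>) \<longlonglongrightarrow> char std_normal_distribution \<theta>"
    unfolding char_std_normal_distribution by (simp add: LIM_zero_iff)
qed

text \<open>Weak convergence gives limits only at continuity points of the limiting
  \<open>cdf\<close>; the normal law has no atoms, so every \<open>x\<close> is one.\<close>

lemma isCont_cdf_std_normal: "isCont (cdf std_normal_distribution) x"
proof -
  interpret real_distribution std_normal_distribution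
    by (rule real_dist_normal_dist)
  have "emeasure std_normal_distribution {x} = 0"
    by (simp add: emeasure_density nn_integral_0_iff_AE AE_lborel_singleton nn_integral_indicator_singleton)
  then show ?thesis
    by (simp add: isCont_cdf measure_def)
qed

theorem theorem1p1:
  fixes c :: real
  assumes "c \<ge> 1"
  shows "\<forall>x::real. ((\<lambda>n::nat. X_std_cdf n (nat \<lfloor>c * real n\<rfloor>) x)
            \<longlongrightarrow> cdf std_normal_distribution x)
          (at_top \<sqinter> principal {n. n > 0 \<and> c * real n \<in> \<int>})"
proof
  fix x
  \<comment> \<open>The limit is taken along all \<open>n\<close>, with \<open>c * n\<close> rounded
    down, and then passes to the smaller filter, on which \<open>c * n\<close> is an integer and the
    floor is exact.\<close>
  have "(\<lambda>n. X_std_cdf n (nat \<lfloor>c * real n\<rfloor>) x) \<longlonglongrightarrow> cdf std_normal_distribution x"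
    using weak_conv_std_length[of "\<lambda>n. nat \<lfloor>c * real n\<rfloor>"] isCont_cdf_std_normal[of x]
    by (simp add: weak_conv_m_def weak_conv_def cdf_std_length)
  then show "((\<lambda>n::nat. X_std_cdf n (nat \<lfloor>c * real n\<rfloor>) x) \<longlongrightarrow> cdf std_normal_distribution x)
      (at_top \<sqinter> principal {n. n > 0 \<and> c * real n \<in> \<int>})"
    by (rule filterlim_mono[OF _ order_refl inf_le1])
qed

end
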